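(* Let $T_h>T_c\ge0$, $L>0$, $A_c>0$ be given constants and let $\kappa\in C^1([T_c,\infty))$ be a given function with $\kappa(T)>0$ for all $T\in[T_c,\infty)$. Then there are a function $\rho$ that is locally Lipschitz continuous on $[T_c,\infty)$ and satisfies $\rho(T)>0$ for all $T\in[T_c,\infty)$ and $\int_{T_c}^\infty\rho(T)\kappa(T)\,dT=\infty$, and constants $R_{\mathrm{load}}>0$, $\alpha_0\neq0$, such that the problem $$(\kappa(T)T_x)_x+\Big(\frac{V}{R[T]A_c}\Big)^2\rho(T)=0\quad\text{for }0<x<L,\qquad T(0)=T_h,\quad T(L)=T_c,$$ where $$R[T]:=\frac{1}{A_c}\int_0^L\rho(T(x))\,dx+R_{\mathrm{load}},\qquad V:=\alpha_0(T_h-T_c),$$ has two different classical solutions.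
   Context: Subscript $x$ denotes $d/dx$. A classical solution is a function $T\in C^2([0,L])$ (with values in $[T_c,\infty)$, where $\kappa$ and $\rho$ are defined) satisfying the equation and the boundary conditions. *)

theory Defs
  imports "HOL-Analysis.Analysis"
begin

text \<open>
  \<open>f \<in> C\<^sup>k(S)\<close> for an interval \<open>S\<close>. Derivatives are taken within \<open>S\<close>, so they are one-sided
  at an endpoint belonging to \<open>S\<close>, and the values of \<open>f\<close> outside \<open>S\<close> play no role.
\<close>
primrec Ck_on :: "nat \<Rightarrow> real set \<Rightarrow> (real \<Rightarrow> real) \<Rightarrow> bool" where
  "Ck_on 0 S f \<longleftrightarrow> continuous_on S f"
| "Ck_on (Suc k) S f \<longleftrightarrow>
     (\<exists>f'. (\<forall>x\<in>S. (f has_real_derivative f' x) (at x within S)) \<and> Ck_on k S f')"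

definition locally_lipschitz_on :: "real set \<Rightarrow> (real \<Rightarrow> real) \<Rightarrow> bool" where
  "locally_lipschitz_on S f \<longleftrightarrow> (\<forall>x\<in>S. \<exists>u>0. \<exists>C. C-lipschitz_on (cball x u \<inter> S) f)"

definition total_resistance ::
    "real \<Rightarrow> real \<Rightarrow> (real \<Rightarrow> real) \<Rightarrow> real \<Rightarrow> (real \<Rightarrow> real) \<Rightarrow> real" where
  "total_resistance L Ac \<rho> Rload T = 1 / Ac * integral {0..L} (\<lambda>x. \<rho> (T x)) + Rload"

text \<open>
  A function on \<open>[0, L]\<close> is represented by a total function of which only the values on
  \<open>[0, L]\<close> matter; \<^term>\<open>deriv T y\<close> is evaluated at interior points only.
\<close>
definition classical_solution ::
    "real \<Rightarrow> real \<Rightarrow> real \<Rightarrow> real \<Rightarrow> (real \<Rightarrow> real) \<Rightarrow> (real \<Rightarrow> real) \<Rightarrow> real \<Rightarrow> real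
      \<Rightarrow> (real \<Rightarrow> real) \<Rightarrow> bool" where
  "classical_solution Th Tc L Ac \<kappa> \<rho> Rload \<alpha>0 T \<longleftrightarrow>
     Ck_on 2 {0..L} T \<and>
     (\<forall>x\<in>{0..L}. Tc \<le> T x) \<and>
     (let V = \<alpha>0 * (Th - Tc); R = total_resistance L Ac \<rho> Rload T in
        \<forall>x\<in>{0<..<L}. \<exists>D.
          ((\<lambda>y. \<kappa> (T y) * deriv T y) has_real_derivative D) (at x) \<and>
          D + (V / (R * Ac))\<^sup>2 * \<rho> (T x) = 0) \<and>
     T 0 = Th \<and> T L = Tc"

end

theory Submission
  imports Defs
begin

text \<open>
  Why two solutions exist. The Kirchhoff transform \<open>u = K(T)\<close> with \<open>K' = \<kappa>\<close> and \<open>K(T\<^sub>c) = 0\<close> turns the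
  flux \<open>\<kappa>(T) T\<^sub>x\<close> into \<open>u\<^sub>x\<close>. Hence, if \<open>\<rho> = g \<circ> K\<close>, the equation reads \<open>u'' + \<lambda>\<^sup>2 g(u) = 0\<close> with
  \<open>u(0) = U = K(T\<^sub>h)\<close> and \<open>u(L) = 0\<close>, where the constant \<open>\<lambda> = V / (R A\<^sub>c)\<close> depends on the solution.
  Conversely, let \<open>u\<close> solve this problem for a prescribed \<open>\<lambda> > 0\<close>. Integrating the equation gives
  \<open>I = \<integral> g(u) = (u'(0) - u'(L)) / \<lambda>\<^sup>2\<close>, so that \<open>u\<close> comes from a solution of the nonlocal problem
  exactly if \<open>\<lambda> (I + A\<^sub>c R\<^sub>l\<^sub>o\<^sub>a\<^sub>d) = V\<close>.

  Two profiles with parameters \<open>\<lambda>\<^sub>1 = 1\<close> and \<open>\<lambda>\<^sub>2 = l > 1\<close> can therefore share the load and \<open>V\<close> if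
  \<open>A\<^sub>c R\<^sub>l\<^sub>o\<^sub>a\<^sub>d = (I\<^sub>1 - l I\<^sub>2) / (l - 1)\<close>, and this is positive as soon as \<open>I\<^sub>1 > l I\<^sub>2\<close>. The freedom to choose
  \<open>\<rho>\<close> makes the latter possible, with the explicit source \<open>g(v) = c + w\<^sup>2 max(0, v - U)\<close>:
  the second profile is a parabola that stays in \<open>[0, U]\<close> and sees the constant source \<open>c\<close>
  (\<open>profile_inside_data_range\<close>); the first one makes a steep trigonometric hump above \<open>U\<close> over a
  short interval \<open>[0, a]\<close> and then falls to \<open>0\<close> along a parabola (\<open>profile_with_hump\<close>).
  The hump collects an extra source, which leaves a margin for some \<open>l > 1\<close>
  (\<open>two_profiles\<close>). For large \<open>w\<close> the hump is low, so \<open>u\<close> does not exceed \<open>K(T\<^sub>h + 1)\<close>. This matters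
  because \<open>K\<close> may be bounded. Above \<open>T\<^sub>h + 1\<close> the function \<open>\<rho>\<close> is met by neither solution, and there
  a term comparable to \<open>t / \<kappa>(t)\<close> is added to make \<open>\<integral> \<rho> \<kappa>\<close> infinite.
  The transfer from profiles back to temperatures is \<open>classical_solution_of_profile\<close>.
\<close>

section \<open>Lipschitz continuity, piecewise derivatives, divergent integrals\<close>

lemma DERIV_piecewise:
  fixes f g :: "real \<Rightarrow> real"
  assumes f: "\<And>x. x \<le> a \<Longrightarrow> (f has_real_derivative f' x) (at x)"
    and g: "\<And>x. a \<le> x \<Longrightarrow> (g has_real_derivative g' x) (at x)"
    and "f a = g a" "f' a = g' a"
  shows "((\<lambda>x. if x \<le> a then f x else g x) has_real_derivative (if x \<le> a then f' x else g' x)) (at x)"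
proof -
  have cl: "closure {..a} \<inter> closure {a<..} = {a}" by auto
  have "((\<lambda>x. if x \<in> {..a} then f x else g x) has_vector_derivative
      (if x \<in> {..a} then f' x else g' x)) (at x within UNIV)"
    by (rule has_vector_derivative_If_within_closures[where T = "{a<..}"])
       (use assms in \<open>auto simp: cl simp flip: has_real_derivative_iff_has_vector_derivative
          intro: has_field_derivative_at_within\<close>)
  then show ?thesis
    by (simp add: has_real_derivative_iff_has_vector_derivative)
qed

lemma C1_lipschitz_on_interval:
  fixes f :: "real \<Rightarrow> real"
  assumes "\<And>x. x \<in> {a..} \<Longrightarrow> (f has_real_derivative f' x) (at x within {a..})"
    and "continuous_on {a..} f'"
  obtains C where "C-lipschitz_on {a..b} f"
proof -
  have "compact (f' ` {a..b})"
    by (rule compact_continuous_image) (use assms(2) in \<open>auto intro: continuous_on_subset\<close>)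
  then have "bounded (f' ` {a..b})" by (rule compact_imp_bounded)
  then obtain M where M: "\<And>x. x \<in> {a..b} \<Longrightarrow> \<bar>f' x\<bar> \<le> M"
    unfolding bounded_iff by (metis image_eqI real_norm_def)
  have "(max 0 M)-lipschitz_on {a..b} f"
  proof (rule bounded_derivative_imp_lipschitz)
    fix x assume x: "x \<in> {a..b}"
    show "(f has_derivative (\<lambda>h. f' x * h)) (at x within {a..b})"
      using has_field_derivative_subset[OF assms(1), of x "{a..b}"] x
      by (auto simp: has_field_derivative_def)
    show "onorm (\<lambda>h. f' x * h) \<le> max 0 M"
      using M[OF x] by (intro onorm_le) (auto simp: abs_mult intro!: mult_right_mono)
  qed auto
  then show ?thesis using that by blast
qed

lemma lipschitz_on_max_0:
  fixes f :: "'a::metric_space \<Rightarrow> real"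
  assumes "C-lipschitz_on S f"
  shows "C-lipschitz_on S (\<lambda>x. max 0 (f x))"
proof (rule lipschitz_onI)
  fix x y assume "x \<in> S" "y \<in> S"
  then have "dist (f x) (f y) \<le> C * dist x y" using lipschitz_onD[OF assms] by blast
  then show "dist (max 0 (f x)) (max 0 (f y)) \<le> C * dist x y"
    by (auto simp: dist_real_def max_def)
qed (use lipschitz_on_nonneg[OF assms] in auto)

lemma locally_lipschitz_onI:
  assumes "\<And>b. \<exists>C. C-lipschitz_on {a..b} f"
  shows "locally_lipschitz_on {a..} f"
  unfolding locally_lipschitz_on_def
proof
  fix x :: real
  obtain C where "C-lipschitz_on {a..x+1} f" using assms by blast
  then have "C-lipschitz_on (cball x 1 \<inter> {a..}) f"
    by (rule lipschitz_on_subset) (auto simp: cball_eq_atLeastAtMost)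
  then show "\<exists>u>0. \<exists>C. C-lipschitz_on (cball x u \<inter> {a..}) f" by (metis zero_less_one)
qed

lemma nn_integral_infinite_halfline:
  fixes f :: "real \<Rightarrow> real"
  assumes "a \<le> b" "\<And>t. t \<ge> b \<Longrightarrow> f t \<ge> 1"
  shows "(\<integral>\<^sup>+t\<in>{a..}. ennreal (f t) \<partial>lborel) = \<infinity>"
proof -
  have "of_nat n \<le> (\<integral>\<^sup>+t\<in>{a..}. ennreal (f t) \<partial>lborel)" for n
  proof -
    have "of_nat n = (\<integral>\<^sup>+t. indicator {b..b + real n} t \<partial>lborel)"
      by (simp add: ennreal_of_nat_eq_real_of_nat)
    also have "\<dots> \<le> (\<integral>\<^sup>+t\<in>{a..}. ennreal (f t) \<partial>lborel)"
    proof (intro nn_integral_mono)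
      fix t
      show "indicator {b..b + real n} t \<le> ennreal (f t) * indicator {a..} t"
        using assms ennreal_leI[of 1 "f t"] by (auto simp: indicator_def)
    qed
    finally show ?thesis .
  qed
  then show ?thesis
    by (metis ennreal_Ex_less_of_nat infinity_ennreal_def leD less_top)
qed

section \<open>The Kirchhoff transform\<close>

text \<open>
  The derivatives of \<open>K\<close> and of its inverse \<open>G\<close> are two-sided even at \<open>T\<^sub>c\<close>, although \<open>\<kappa>\<close> is
  known on \<open>[T\<^sub>c, \<infinity>)\<close> alone: \<open>K\<close> is built from the continuous positive extension of \<open>\<kappa>\<close> that is
  constant to the left of \<open>T\<^sub>c\<close>. A composition \<open>G \<circ> u\<close> can then be differentiated by the ordinary
  chain rule also where it takes the boundary value \<open>T\<^sub>c\<close>.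
\<close>
lemma kirchhoff_transform:
  fixes \<kappa> :: "real \<Rightarrow> real"
  assumes cont: "continuous_on {Tc..} \<kappa>" and pos: "\<And>t. t \<ge> Tc \<Longrightarrow> \<kappa> t > 0"
  obtains K G :: "real \<Rightarrow> real" where
    "K Tc = 0"
    "strict_mono_on {Tc..} K"
    "\<And>t. t \<ge> Tc \<Longrightarrow> (K has_real_derivative \<kappa> t) (at t)"
    "\<And>t. t \<ge> Tc \<Longrightarrow> G (K t) = t"
    "\<And>t. t \<ge> Tc \<Longrightarrow> (G has_real_derivative inverse (\<kappa> t)) (at (K t))"
proof -
  define k where "k = (\<lambda>t. \<kappa> (max Tc t))"
  have k_cont: "continuous_on UNIV k"
    unfolding k_def by (rule continuous_on_compose2[OF cont]) (auto intro!: continuous_intros)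
  have k_pos: "k t > 0" for t using pos by (simp add: k_def)
  define K where "K = (\<lambda>t. integral {Tc-1..t} k - integral {Tc-1..Tc} k)"
  have K_deriv: "(K has_real_derivative k t) (at t)" if "t > Tc - 1" for t
  proof -
    have "((\<lambda>x. integral {Tc-1..x} k) has_real_derivative k t) (at t within {Tc-1..t+1})"
      by (rule integral_has_real_derivative) (use that k_cont in \<open>auto intro: continuous_on_subset\<close>)
    moreover have "at t within {Tc-1..t+1} = at t"
      using that by (intro at_within_interior) auto
    ultimately show ?thesis
      unfolding K_def by (auto intro!: derivative_eq_intros)
  qed
  have K_less: "K s < K t" if "Tc - 1 < s" "s < t" for s t
  proof (rule DERIV_pos_imp_increasing[OF that(2)])
    fix x assume "s \<le> x" "x \<le> t"
    then show "\<exists>y. (K has_real_derivative y) (at x) \<and> y > 0"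
      using K_deriv[of x] k_pos that by auto
  qed
  have inj: "inj_on K {Tc-1<..}"
    by (rule linorder_inj_onI) (use K_less in fastforce)+
  define G where "G = the_inv_into {Tc-1<..} K"
  have GK: "G (K t) = t" if "t > Tc - 1" for t
    unfolding G_def using that inj by (simp add: the_inv_into_f_f)
  have K_isCont: "isCont K t" if "t > Tc - 1" for t
    using K_deriv[OF that] DERIV_isCont by blast
  have "(G has_real_derivative inverse (\<kappa> t)) (at (K t))" if t: "t \<ge> Tc" for t
  proof (rule DERIV_inverse_function)
    show "(K has_real_derivative \<kappa> t) (at (G (K t)))"
      using K_deriv[of t] GK[of t] t by (simp add: k_def max_def)
    show "\<kappa> t \<noteq> 0" using pos[OF t] by simp
    show "K (Tc - 1/2) < K t" "K t < K (t + 1)" using t by (auto intro!: K_less)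
    show "isCont G (K t)"
    proof (rule isCont_inverse_function[where f = K and x = t and d = "1/2"])
      fix z assume "\<bar>z - t\<bar> \<le> 1/2"
      then have "z > Tc - 1" using t by linarith
      then show "G (K z) = z" "isCont K z" using GK K_isCont by auto
    qed simp
    fix y assume y: "K (Tc - 1/2) < y" "y < K (t + 1)"
    have "\<exists>s\<ge>Tc-1/2. s \<le> t+1 \<and> K s = y"
      by (rule IVT) (use y t in \<open>auto intro!: K_isCont\<close>)
    then show "K (G y) = y" using GK by auto
  qed
  moreover have "(K has_real_derivative \<kappa> t) (at t)" if "t \<ge> Tc" for t
    using K_deriv[of t] that by (simp add: k_def max_def)
  moreover have "strict_mono_on {Tc..} K"
    by (rule strict_mono_onI) (use K_less in auto)
  ultimately show ?thesis
    using that[of K G] GK by (simp add: K_def)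
qed

lemma left_inverse_imp_inverse:
  fixes K G :: "real \<Rightarrow> real"
  assumes "a \<le> b" and "\<And>t. t \<in> {a..b} \<Longrightarrow> isCont K t" and GK: "\<And>t. t \<in> {a..b} \<Longrightarrow> G (K t) = t"
    and "v \<in> {K a..K b}"
  shows "G v \<in> {a..b} \<and> K (G v) = v"
proof -
  have "\<exists>t\<ge>a. t \<le> b \<and> K t = v"
    by (rule IVT) (use assms in auto)
  then obtain t where "t \<in> {a..b}" "K t = v" by auto
  then show ?thesis using GK[of t] by simp
qed

section \<open>From profiles to temperatures\<close>

text \<open>
  Solutions of \<open>u'' + g(u) = 0\<close>, \<open>u(0) = U\<close>, \<open>u(L) = 0\<close> with values in \<open>[0, B]\<close>. The derivatives are
  required on the whole line, so that no one-sided derivatives occur; the equation itself is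
  required on \<open>[0, L]\<close>. The derivative \<open>p = u'\<close> is an argument because \<open>p(0) - p(L)\<close> is the integral
  of the source \<open>g(u)\<close>.
\<close>
definition Dirichlet_profile ::
    "real \<Rightarrow> real \<Rightarrow> real \<Rightarrow> (real \<Rightarrow> real) \<Rightarrow> (real \<Rightarrow> real) \<Rightarrow> (real \<Rightarrow> real) \<Rightarrow> bool" where
  "Dirichlet_profile L U B g u p \<longleftrightarrow>
     (\<exists>q. (\<forall>x. (u has_real_derivative p x) (at x)) \<and> (\<forall>x. (p has_real_derivative q x) (at x)) \<and>
          continuous_on UNIV q \<and> (\<forall>x\<in>{0..L}. 0 \<le> u x \<and> u x \<le> B \<and> q x = - g (u x))) \<and>
     u 0 = U \<and> u L = 0"

text \<open>
  With \<open>T = G(u)\<close> one has \<open>\<kappa>(T) T' = u'\<close>, so the heat equation becomes the profile equation once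
  \<open>V / (R A\<^sub>c) = \<lambda>\<close>. The fundamental theorem of calculus, applied to \<open>u'\<close>, identifies
  \<open>\<integral> \<rho>(T)\<close> with \<open>(p(0) - p(L)) / \<lambda>\<^sup>2\<close>, which turns the assumption on \<open>\<alpha>\<^sub>0 (T\<^sub>h - T\<^sub>c)\<close> into this
  relation. The source \<open>\<rho>\<close> has to agree with \<open>g \<circ> K\<close> only on the range \<open>[T\<^sub>c, T\<^sub>b]\<close> of the solution.
\<close>
lemma classical_solution_of_profile:
  fixes K G :: "real \<Rightarrow> real"
  assumes "L > 0" "Ac > 0" "Tc \<le> Th" "Tc \<le> Tb"
    and \<kappa>_C1: "Ck_on 1 {Tc..} \<kappa>" and \<kappa>_pos: "\<And>t. t \<ge> Tc \<Longrightarrow> \<kappa> t > 0"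
    and K_Tc: "K Tc = 0"
    and K_deriv: "\<And>t. t \<ge> Tc \<Longrightarrow> (K has_real_derivative \<kappa> t) (at t)"
    and GK: "\<And>t. t \<ge> Tc \<Longrightarrow> G (K t) = t"
    and G_deriv: "\<And>t. t \<ge> Tc \<Longrightarrow> (G has_real_derivative inverse (\<kappa> t)) (at (K t))"
    and \<rho>_eq: "\<And>t. t \<in> {Tc..Tb} \<Longrightarrow> \<rho> t = g (K t)"
    and profile: "Dirichlet_profile L (K Th) (K Tb) (\<lambda>v. lam\<^sup>2 * g v) u p"
    and lam: "lam > 0" and "\<alpha>0 * (Th - Tc) \<noteq> 0"
    and V_eq: "\<alpha>0 * (Th - Tc) = (p 0 - p L) / lam + lam * Ac * Rload"
  shows "classical_solution Th Tc L Ac \<kappa> \<rho> Rload \<alpha>0 (\<lambda>x. G (u x))"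
proof -
  obtain q where u: "\<And>x. (u has_real_derivative p x) (at x)"
    and p: "\<And>x. (p has_real_derivative q x) (at x)"
    and q: "continuous_on UNIV q"
    and range: "\<And>x. x \<in> {0..L} \<Longrightarrow> 0 \<le> u x \<and> u x \<le> K Tb"
    and ode: "\<And>x. x \<in> {0..L} \<Longrightarrow> q x = - (lam\<^sup>2 * g (u x))"
    and bc: "u 0 = K Th" "u L = 0"
    using profile unfolding Dirichlet_profile_def by blast
  define T where "T = (\<lambda>x. G (u x))"
  have T: "T x \<in> {Tc..Tb} \<and> K (T x) = u x" if "x \<in> {0..L}" for x
  proof -
    have "u x \<in> {K Tc..K Tb}" using range[OF that] K_Tc by simp
    then have "G (u x) \<in> {Tc..Tb} \<and> K (G (u x)) = u x"
      by (intro left_inverse_imp_inverse \<open>Tc \<le> Tb\<close> DERIV_isCont[OF K_deriv] GK) auto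
    then show ?thesis by (simp add: T_def)
  qed
  have \<kappa>T_pos: "\<kappa> (T x) > 0" if "x \<in> {0..L}" for x
    using T[OF that] \<kappa>_pos by simp
  have T_deriv: "(T has_real_derivative p x / \<kappa> (T x)) (at x)" if "x \<in> {0..L}" for x
  proof -
    have "(G has_real_derivative inverse (\<kappa> (T x))) (at (u x))"
      using G_deriv[of "T x"] T[OF that] by simp
    from DERIV_chain2[OF this u[of x]] show ?thesis
      by (simp add: T_def divide_inverse mult.commute)
  qed
  obtain \<kappa>' where \<kappa>': "\<And>t. t \<in> {Tc..} \<Longrightarrow> (\<kappa> has_real_derivative \<kappa>' t) (at t within {Tc..})"
    and \<kappa>'_cont: "continuous_on {Tc..} \<kappa>'"
    using \<kappa>_C1 by auto
  have \<kappa>_cont: "continuous_on {Tc..} \<kappa>"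
    using \<kappa>' DERIV_continuous_on by blast
  have T_cont: "continuous_on {0..L} T"
    using T_deriv by (intro DERIV_continuous_on) (auto intro: has_field_derivative_at_within)
  have p_cont: "continuous_on S p" for S
    using p by (intro DERIV_continuous_on) (auto intro: has_field_derivative_at_within)
  have T_range: "T ` {0..L} \<subseteq> {Tc..}" using T by fastforce
  have \<kappa>T_deriv: "((\<lambda>y. \<kappa> (T y)) has_real_derivative \<kappa>' (T x) * (p x / \<kappa> (T x)))
      (at x within {0..L})" if x: "x \<in> {0..L}" for x
  proof -
    have "(\<kappa> has_real_derivative \<kappa>' (T x)) (at (T x) within T ` {0..L})"
      by (rule has_field_derivative_subset[OF \<kappa>' T_range]) (use T[OF x] in simp)
    from DERIV_image_chain[OF this has_field_derivative_at_within[OF T_deriv[OF x]]]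
    show ?thesis by (simp add: o_def)
  qed
  define T2 where "T2 = (\<lambda>x. (q x * \<kappa> (T x) - p x * (\<kappa>' (T x) * (p x / \<kappa> (T x)))) / (\<kappa> (T x))\<^sup>2)"
  have T2: "((\<lambda>x. p x / \<kappa> (T x)) has_real_derivative T2 x) (at x within {0..L})"
    if x: "x \<in> {0..L}" for x
    unfolding T2_def power2_eq_square
    by (rule DERIV_divide[OF has_field_derivative_at_within[OF p] \<kappa>T_deriv[OF x]])
       (use \<kappa>T_pos[OF x] in auto)
  have "continuous_on {0..L} T2"
    unfolding T2_def
    by (intro continuous_intros p_cont continuous_on_subset[OF q]
          continuous_on_compose2[OF \<kappa>_cont T_cont T_range]
          continuous_on_compose2[OF \<kappa>'_cont T_cont T_range])
       (use \<kappa>T_pos in \<open>force+\<close>)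
  then have "Ck_on 1 {0..L} (\<lambda>x. p x / \<kappa> (T x))"
    unfolding One_nat_def Ck_on.simps using T2 by blast
  moreover have "\<forall>x\<in>{0..L}. (T has_real_derivative p x / \<kappa> (T x)) (at x within {0..L})"
    using T_deriv has_field_derivative_at_within by blast
  ultimately have "Ck_on (Suc 1) {0..L} T"
    unfolding Ck_on.simps(2) by (intro exI conjI)
  then have T_C2: "Ck_on 2 {0..L} T"
    by (simp only: Suc_1)
  have \<rho>T: "\<rho> (T x) = - q x / lam\<^sup>2" if "x \<in> {0..L}" for x
    using \<rho>_eq[of "T x"] T[OF that] ode[OF that] lam by (simp add: field_simps)
  have "((\<lambda>x. - q x / lam\<^sup>2) has_integral (- p L / lam\<^sup>2 - - p 0 / lam\<^sup>2)) {0..L}"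
  proof (rule fundamental_theorem_of_calculus)
    fix x
    have "((\<lambda>x. - p x / lam\<^sup>2) has_real_derivative - q x / lam\<^sup>2) (at x within {0..L})"
      using DERIV_cdivide[OF DERIV_minus[OF p]] by (rule has_field_derivative_at_within)
    then show "((\<lambda>x. - p x / lam\<^sup>2) has_vector_derivative - q x / lam\<^sup>2) (at x within {0..L})"
      by (simp add: has_real_derivative_iff_has_vector_derivative)
  qed (use \<open>L > 0\<close> in simp)
  then have "integral {0..L} (\<lambda>x. - q x / lam\<^sup>2) = (p 0 - p L) / lam\<^sup>2"
    by (subst integral_unique) (auto simp: diff_divide_distrib)
  moreover have "integral {0..L} (\<lambda>x. \<rho> (T x)) = integral {0..L} (\<lambda>x. - q x / lam\<^sup>2)"
    using \<rho>T by (rule integral_cong)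
  ultimately have "lam * (total_resistance L Ac \<rho> Rload T * Ac) = \<alpha>0 * (Th - Tc)"
    unfolding total_resistance_def V_eq using \<open>Ac > 0\<close> lam
    by (simp add: field_simps power2_eq_square)
  then have current: "\<alpha>0 * (Th - Tc) / (total_resistance L Ac \<rho> Rload T * Ac) = lam"
    using \<open>\<alpha>0 * (Th - Tc) \<noteq> 0\<close> by (metis mult_zero_right nonzero_mult_div_cancel_right)
  have flux: "((\<lambda>y. \<kappa> (T y) * deriv T y) has_real_derivative q x) (at x)" if x: "x \<in> {0<..<L}" for x
  proof (rule has_field_derivative_transform_within_open[OF p])
    fix y assume "y \<in> {0<..<L}"
    then have "y \<in> {0..L}" by simp
    then show "p y = \<kappa> (T y) * deriv T y"
      using DERIV_imp_deriv[OF T_deriv] \<kappa>T_pos[of y] by simp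
  qed (use x in auto)
  have "T 0 = Th" "T L = Tc"
    using GK[of Th] GK[of Tc] bc K_Tc \<open>Tc \<le> Th\<close> by (auto simp: T_def)
  moreover have "\<forall>x\<in>{0<..<L}. \<exists>D. ((\<lambda>y. \<kappa> (T y) * deriv T y) has_real_derivative D) (at x) \<and>
          D + lam\<^sup>2 * \<rho> (T x) = 0"
    using flux \<rho>T lam by (intro ballI exI[of _ "q _"]) auto
  ultimately show ?thesis
    using T T_C2 unfolding classical_solution_def Let_def T_def[symmetric] current by simp
qed

section \<open>Two explicit profiles\<close>

text \<open>
  The parabola with second derivative \<open>- l\<^sup>2 c\<close>, written with the factor \<open>1 - x/L\<close> made visible.
  The bound on \<open>l\<^sup>2 c L\<^sup>2\<close> says that its slope at \<open>0\<close> is at most \<open>0\<close>; being concave it then never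
  exceeds \<open>U\<close>, where the source is constant. The quantitative bound on \<open>u\<close> shows that it lies
  strictly below \<open>U\<close> for \<open>x > 0\<close> if \<open>U > 0\<close>.
\<close>
lemma profile_inside_data_range:
  fixes L U c l :: real
  assumes "L > 0" "U \<ge> 0" "l\<^sup>2 * c * L\<^sup>2 \<le> 2 * U" "c \<ge> 0" "U \<le> B"
    and g: "\<And>v. v \<le> U \<Longrightarrow> g v = l\<^sup>2 * c"
  defines "u \<equiv> \<lambda>x. (1 - x / L) * (U + l\<^sup>2 * c * L * x / 2)"
  obtains p where "Dirichlet_profile L U B g u p" "p 0 - p L = l\<^sup>2 * c * L"
    "\<And>x. x \<in> {0..L} \<Longrightarrow> u x \<le> U * (1 - (x / L)\<^sup>2)"
proof -
  have le: "u x \<le> U * (1 - (x / L)\<^sup>2)" if x: "x \<in> {0..L}" for x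
  proof -
    have "(l\<^sup>2 * c * L\<^sup>2) * (x / L) \<le> (2 * U) * (x / L)"
      using assms x by (intro mult_right_mono) auto
    then have "U + l\<^sup>2 * c * L * x / 2 \<le> U + U * (x / L)"
      using \<open>L > 0\<close> by (simp add: power2_eq_square mult_ac)
    then have "u x \<le> (1 - x / L) * (U + U * (x / L))"
      unfolding u_def using x \<open>L > 0\<close> by (intro mult_left_mono) auto
    also have "\<dots> = U * (1 - (x / L)\<^sup>2)" by algebra
    finally show ?thesis .
  qed
  have le_U: "u x \<le> U" if "x \<in> {0..L}" for x
    using le[OF that] \<open>U \<ge> 0\<close> by (smt (verit) mult_left_le zero_le_power2)
  define p where "p = (\<lambda>x. - U / L + l\<^sup>2 * c * (L / 2 - x))"
  have "Dirichlet_profile L U B g u p"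
    unfolding Dirichlet_profile_def
  proof (intro conjI exI[of _ "\<lambda>x. - l\<^sup>2 * c"] allI ballI)
    fix x
    show "(u has_real_derivative p x) (at x)"
      unfolding u_def p_def using \<open>L > 0\<close>
      by (auto intro!: derivative_eq_intros simp: field_simps power2_eq_square)
    show "(p has_real_derivative - l\<^sup>2 * c) (at x)"
      unfolding p_def by (auto intro!: derivative_eq_intros)
  next
    fix x assume x: "x \<in> {0..L}"
    show "u x \<ge> 0" unfolding u_def using x assms(1-4) by simp
    show "u x \<le> B" using le_U[OF x] \<open>U \<le> B\<close> by simp
    show "- l\<^sup>2 * c = - g (u x)" using g le_U[OF x] by simp
  qed (use \<open>L > 0\<close> in \<open>auto simp: u_def\<close>)
  moreover have "p 0 - p L = l\<^sup>2 * c * L" by (simp add: p_def algebra_simps)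
  ultimately show ?thesis using le that by blast
qed

text \<open>
  Above \<open>U\<close> the equation is linear, \<open>e'' = - (c + w\<^sup>2 e)\<close> for the excess \<open>e = u - U\<close>. With
  \<open>\<theta> = arctan 8\<close> the solution used is \<open>e = (c / w\<^sup>2) (cos (w x - \<theta>) / cos \<theta> - 1)\<close>, which is
  positive between its zeros \<open>0\<close> and \<open>a = 2 \<theta> / w\<close> and has the slopes \<open>8 c / w\<close> and \<open>- 8 c / w\<close>
  there. On \<open>[a, L]\<close> it continues as the parabola of second derivative \<open>- c\<close>, and the relation between
  \<open>c\<close> and \<open>U\<close> says that this parabola ends at \<open>0\<close>. Value, slope and second derivative match at \<open>a\<close>,
  so the composite is \<open>C\<^sup>2\<close>.
\<close>
lemma profile_with_hump:
  fixes L U B w a c :: real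
  assumes "L > 0" "U \<ge> 0" "w > 0" "c > 0" "a < L"
    and a: "a = 2 * arctan 8 / w"
    and hump: "8 * c / w\<^sup>2 \<le> B - U"
    and c: "8 * c / w * (L - a) + c * (L - a)\<^sup>2 / 2 = U"
    and g: "\<And>v. g v = c + w\<^sup>2 * max 0 (v - U)"
  obtains u p where "Dirichlet_profile L U B g u p" "p 0 - p L = 16 * c / w + c * (L - a)" "u a = U"
proof -
  define u1 p1 q1 where "u1 = (\<lambda>x. U + c / w\<^sup>2 * (cos (w * x) + 8 * sin (w * x) - 1))"
    and "p1 = (\<lambda>x. c / w * (8 * cos (w * x) - sin (w * x)))"
    and "q1 = (\<lambda>x. - c * (cos (w * x) + 8 * sin (w * x)))"
  define u2 p2 where "u2 = (\<lambda>x. U - 8 * c / w * (x - a) - c * (x - a)\<^sup>2 / 2)"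
    and "p2 = (\<lambda>x. - 8 * c / w - c * (x - a))"
  define u p q where "u = (\<lambda>x. if x \<le> a then u1 x else u2 x)"
    and "p = (\<lambda>x. if x \<le> a then p1 x else p2 x)"
    and "q = (\<lambda>x. if x \<le> a then q1 x else - c)"
  define \<theta> where "\<theta> = arctan 8"
  have \<theta>: "0 < \<theta>" "2 * \<theta> < pi" "cos \<theta> > 0" "sin \<theta> = 8 * cos \<theta>"
    using arctan_ubound[of 8] cos_arctan_not_zero[of 8] tan_arctan[of 8]
    by (auto simp: \<theta>_def tan_def field_simps zero_less_arctan_iff cos_arctan add_pos_pos)
  have [simp]: "w \<noteq> 0" using \<open>w > 0\<close> by simp
  have a_pos: "a > 0" and wa: "w * a = 2 * \<theta>" using a \<theta> \<open>w > 0\<close> by (auto simp: \<theta>_def)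
  \<comment> \<open>Factoring out the phase \<open>\<theta>\<close> exhibits the symmetry of the hump about \<open>a / 2\<close>.\<close>
  have shift: "(cos y + 8 * sin y) * cos \<theta> = cos (y - \<theta>)" for y
    using \<theta> by (simp add: cos_diff algebra_simps)
  have shift': "(8 * cos y - sin y) * cos \<theta> = - sin (y - \<theta>)" for y
    using \<theta> by (simp add: sin_diff algebra_simps)
  have "(cos (w * a) + 8 * sin (w * a)) * cos \<theta> = 1 * cos \<theta>"
    "(8 * cos (w * a) - sin (w * a)) * cos \<theta> = (- 8) * cos \<theta>"
    using shift[of "w * a"] shift'[of "w * a"] \<theta> by (auto simp: wa)
  then have at_a: "cos (w * a) + 8 * sin (w * a) = 1" "8 * cos (w * a) - sin (w * a) = - 8"
    using \<theta>(3) by (metis less_irrefl mult_right_cancel)+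
  have u_deriv: "(u has_real_derivative p x) (at x)" for x
    unfolding u_def p_def
  proof (rule DERIV_piecewise)
    show "(u1 has_real_derivative p1 y) (at y)" for y
      unfolding u1_def p1_def using \<open>w > 0\<close>
      by (auto intro!: derivative_eq_intros simp: field_simps power2_eq_square)
    show "(u2 has_real_derivative p2 y) (at y)" for y
      unfolding u2_def p2_def by (auto intro!: derivative_eq_intros)
  qed (auto simp: u1_def u2_def p1_def p2_def at_a)
  have p_deriv: "(p has_real_derivative q x) (at x)" for x
    unfolding p_def q_def
  proof (rule DERIV_piecewise)
    show "(p1 has_real_derivative q1 y) (at y)" for y
      unfolding p1_def q1_def using \<open>w > 0\<close>
      by (auto intro!: derivative_eq_intros simp: field_simps power2_eq_square)
    show "(p2 has_real_derivative - c) (at y)" for y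
      unfolding p2_def by (auto intro!: derivative_eq_intros)
  qed (auto simp: q1_def p1_def p2_def at_a)
  have "continuous_on ({..a} \<union> {a..}) q"
    unfolding q_def
    by (rule continuous_on_If) (auto simp: q1_def at_a intro!: continuous_intros)
  moreover have "{..a} \<union> {a..} = UNIV" by auto
  ultimately have q_cont: "continuous_on UNIV q" by simp
  have left: "U \<le> u x \<and> u x \<le> B \<and> q x = - g (u x)" if x: "0 \<le> x" "x \<le> a" for x
  proof -
    have "\<bar>w * x - \<theta>\<bar> \<le> \<theta>"
      using x \<open>w > 0\<close> mult_left_mono[OF x(2), of w] wa by (auto simp: abs_le_iff)
    then have "cos \<theta> \<le> cos (w * x - \<theta>)"
      using \<theta> cos_monotone_0_pi_le[of "\<bar>w * x - \<theta>\<bar>" \<theta>] by auto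
    then have "1 \<le> cos (w * x) + 8 * sin (w * x)"
      using shift[of "w * x"] \<theta>(3) by (metis mult_le_cancel_right_pos mult_1)
    moreover have "cos (w * x) + 8 * sin (w * x) \<le> 1 + 8"
      by (intro add_mono) auto
    moreover define e where "e = c / w\<^sup>2 * (cos (w * x) + 8 * sin (w * x) - 1)"
    ultimately have "0 \<le> e" "e \<le> c / w\<^sup>2 * 8"
      using \<open>c > 0\<close> unfolding e_def by (intro mult_nonneg_nonneg mult_left_mono; simp)+
    moreover have "u x = U + e" "q x = - (c + w\<^sup>2 * e)"
      using x by (simp_all add: u_def u1_def q_def q1_def e_def algebra_simps)
    ultimately show ?thesis using hump by (simp add: g mult.commute)
  qed
  have right: "0 \<le> u x \<and> u x \<le> U \<and> q x = - g (u x)" if x: "a < x" "x \<le> L" for x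
  proof -
    have "8 * c / w * (x - a) + c * (x - a)\<^sup>2 / 2 \<le> 8 * c / w * (L - a) + c * (L - a)\<^sup>2 / 2"
      using x \<open>c > 0\<close> \<open>w > 0\<close> by (intro add_mono mult_left_mono divide_right_mono power_mono) auto
    moreover have "0 \<le> 8 * c / w * (x - a) + c * (x - a)\<^sup>2 / 2"
      using x \<open>c > 0\<close> \<open>w > 0\<close> by simp
    ultimately show ?thesis
      using x c by (auto simp: u_def u2_def q_def g)
  qed
  have "u 0 = U" "u L = 0" "u a = U"
    using a_pos \<open>a < L\<close> c by (auto simp: u_def u1_def u2_def at_a)
  moreover have "U \<le> B"
    using left[of 0] a_pos by auto
  then have "0 \<le> u x \<and> u x \<le> B \<and> q x = - g (u x)" if "x \<in> {0..L}" for x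
    using left[of x] right[of x] that \<open>U \<ge> 0\<close> by fastforce
  ultimately have "Dirichlet_profile L U B g u p"
    unfolding Dirichlet_profile_def using u_deriv p_deriv q_cont by blast
  moreover have "p 0 - p L = 16 * c / w + c * (L - a)"
    using a_pos \<open>a < L\<close> by (simp add: p_def p1_def p2_def)
  ultimately show ?thesis using that \<open>u a = U\<close> by blast
qed

text \<open>
  The two limits on \<open>l > 1\<close> are \<open>l\<^sup>2 c L\<^sup>2 \<le> 2 U\<close>, which keeps the second profile below \<open>U\<close>, and
  \<open>l L < 16 / w + (L - a)\<close>, which makes the comparison of the fluxes strict. Both leave room above
  \<open>1\<close> because the slope \<open>8 c / w\<close> of the hump is large compared with its length \<open>a\<close>:
  \<open>w a = 2 arctan 8 < 4\<close>. To first order in \<open>1 / w\<close>, the first limit needs \<open>16 L / w > 2 L a\<close>,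
  the second \<open>16 / w > a\<close>; this is why the tangent \<open>8\<close> works, while a small one would not.
\<close>
lemma two_profiles:
  fixes L U B :: real
  assumes "L > 0" "0 < U" "U < B"
  obtains c k l u1 p1 u2 p2 where
    "c > 0" "k > 0" "l > 1"
    "Dirichlet_profile L U B (\<lambda>v. c + k * max 0 (v - U)) u1 p1"
    "Dirichlet_profile L U B (\<lambda>v. l\<^sup>2 * (c + k * max 0 (v - U))) u2 p2"
    "0 < (p2 0 - p2 L) / l" "(p2 0 - p2 L) / l < p1 0 - p1 L"
    "\<exists>x\<in>{0..L}. u1 x \<noteq> u2 x"
proof -
  \<comment> \<open>The factor \<open>8 / L\<close> gives \<open>a < L / 2\<close> and thus \<open>c \<le> 8 U / L\<^sup>2\<close>; the other factor, whose square
    exceeds \<open>U / (B - U)\<close>, then keeps the height of the hump below \<open>B - U\<close>.\<close>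
  define w where "w = 8 / L * (1 + U / (B - U))"
  define a where "a = 2 * arctan 8 / w"
  define c where "c = U / (8 / w * (L - a) + (L - a)\<^sup>2 / 2)"
  have ratio: "U / (B - U) > 0" using assms by simp
  have w_ge: "w \<ge> 8 / L" unfolding w_def
    using mult_left_mono[of 1 "1 + U / (B - U)" "8 / L"] ratio \<open>L > 0\<close> by simp
  then have w_pos: "w > 0" using \<open>L > 0\<close> by (smt (verit) divide_pos_pos)
  have wL: "w * L \<ge> 8" using w_ge \<open>L > 0\<close> by (simp add: field_simps)
  have a_pos: "a > 0" using w_pos by (simp add: a_def zero_less_arctan_iff)
  have "2 * arctan 8 < 4" using arctan_ubound[of 8] pi_less_4 by linarith
  then have wa: "w * a < 4" using w_pos by (simp add: a_def)
  then have "w * a < w * (L / 2)" using wL by simp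
  then have a_half: "a < L / 2" using w_pos mult_less_cancel_left_pos by blast
  have den_pos: "8 / w * (L - a) + (L - a)\<^sup>2 / 2 > 0"
    using a_half w_pos \<open>L > 0\<close> by (intro add_pos_pos) auto
  have c_pos: "c > 0" using den_pos \<open>U > 0\<close> by (simp add: c_def)
  have c_eq: "c * (8 / w * (L - a) + (L - a)\<^sup>2 / 2) = U"
    using den_pos by (simp add: c_def)
  have c_le: "c * L\<^sup>2 / 8 \<le> U"
  proof -
    have "(L / 2)\<^sup>2 \<le> (L - a)\<^sup>2" using a_half \<open>L > 0\<close> by (intro power_mono) auto
    then have "L\<^sup>2 / 4 \<le> (L - a)\<^sup>2" by (simp add: power_divide)
    moreover have "0 \<le> 8 / w * (L - a)" using a_half w_pos \<open>L > 0\<close> by simp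
    ultimately have "L\<^sup>2 / 8 \<le> 8 / w * (L - a) + (L - a)\<^sup>2 / 2"
      by linarith
    then have "c * (L\<^sup>2 / 8) \<le> U"
      unfolding c_eq[symmetric] using c_pos by (intro mult_left_mono) auto
    then show ?thesis by simp
  qed
  have hump: "8 * c / w\<^sup>2 \<le> B - U"
  proof -
    define y where "y = U / (B - U)"
    have y: "y > 0" "y * (B - U) = U" using ratio assms by (auto simp: y_def)
    have "w = 8 / L * (1 + y)" unfolding w_def y_def by (rule refl)
    then have "w\<^sup>2 = 64 / L\<^sup>2 * (1 + y)\<^sup>2" by (simp only: power_mult_distrib power_divide) simp
    moreover have "y \<le> (1 + y)\<^sup>2" using y by (simp add: power2_eq_square algebra_simps)
    ultimately have "64 / L\<^sup>2 * y \<le> w\<^sup>2"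
      using mult_left_mono[of y "(1 + y)\<^sup>2" "64 / L\<^sup>2"] by simp
    then have "64 / L\<^sup>2 * y * (B - U) \<le> w\<^sup>2 * (B - U)"
      using assms by (intro mult_right_mono) auto
    then have "64 / L\<^sup>2 * U \<le> w\<^sup>2 * (B - U)" using y by (simp add: mult.assoc)
    moreover have "8 * c \<le> 64 / L\<^sup>2 * U" using c_le \<open>L > 0\<close> by (simp add: field_simps)
    ultimately show ?thesis using w_pos by (simp add: field_simps)
  qed
  \<comment> \<open>The two limits become \<open>l\<^sup>2 \<le> X\<close> and \<open>l < Y\<close>.\<close>
  define X Y where "X = 2 * U / (c * L\<^sup>2)" and "Y = (16 / w + (L - a)) / L"
  have "X > 1"
  proof -
    have "a * w * (2 * L) \<le> 4 * (2 * L)" using wa \<open>L > 0\<close> by (intro mult_right_mono) (auto simp: mult.commute)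
    then have "2 * L * a \<le> 8 * L / w" using w_pos by (simp add: field_simps)
    moreover have "8 * L / w < 16 * (L - a) / w"
      using a_half w_pos by (intro divide_strict_right_mono) auto
    moreover have "(L - a)\<^sup>2 = L\<^sup>2 - 2 * L * a + a\<^sup>2" by (simp add: power2_eq_square algebra_simps)
    moreover have "16 / w * (L - a) = 16 * (L - a) / w" by simp
    ultimately have "L\<^sup>2 < 16 / w * (L - a) + (L - a)\<^sup>2" using zero_le_power2[of a] by linarith
    then have "c * L\<^sup>2 < c * (16 / w * (L - a) + (L - a)\<^sup>2)" using c_pos by simp
    also have "16 / w * (L - a) + (L - a)\<^sup>2 = 2 * (8 / w * (L - a) + (L - a)\<^sup>2 / 2)"
      by (simp add: distrib_left)
    also have "c * \<dots> = 2 * U" using c_eq by (metis mult.left_commute)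
    finally show ?thesis using c_pos \<open>L > 0\<close> by (simp add: X_def)
  qed
  have "Y > 1"
  proof -
    have "a < 16 / w" using wa w_pos by (simp add: field_simps)
    then show ?thesis using \<open>L > 0\<close> by (simp add: Y_def)
  qed
  obtain l where l: "1 < l" "l < min (sqrt X) Y"
    using dense[of 1 "min (sqrt X) Y"] \<open>X > 1\<close> \<open>Y > 1\<close> by auto
  have "l\<^sup>2 \<le> (sqrt X)\<^sup>2" using l by (intro power_mono) auto
  then have "l\<^sup>2 \<le> X" using \<open>X > 1\<close> by simp
  then have l_sq: "l\<^sup>2 * c * L\<^sup>2 \<le> 2 * U"
    using c_pos \<open>L > 0\<close> by (simp add: X_def pos_le_divide_eq mult.assoc)
  have g_below: "l\<^sup>2 * (c + w\<^sup>2 * max 0 (v - U)) = l\<^sup>2 * c" if "v \<le> U" for v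
    using that by simp
  obtain u2 p2 where u2: "Dirichlet_profile L U B (\<lambda>v. l\<^sup>2 * (c + w\<^sup>2 * max 0 (v - U))) u2 p2"
    "p2 0 - p2 L = l\<^sup>2 * c * L" "\<And>x. x \<in> {0..L} \<Longrightarrow> u2 x \<le> U * (1 - (x / L)\<^sup>2)"
    using profile_inside_data_range[where g = "\<lambda>v. l\<^sup>2 * (c + w\<^sup>2 * max 0 (v - U))",
        OF \<open>L > 0\<close> less_imp_le[OF \<open>U > 0\<close>] l_sq less_imp_le[OF c_pos]
        less_imp_le[OF \<open>U < B\<close>] g_below] by blast
  obtain u1 p1 where u1: "Dirichlet_profile L U B (\<lambda>v. c + w\<^sup>2 * max 0 (v - U)) u1 p1"
    "p1 0 - p1 L = 16 * c / w + c * (L - a)" "u1 a = U"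
  proof (rule profile_with_hump)
    show "8 * c / w * (L - a) + c * (L - a)\<^sup>2 / 2 = U"
      using c_eq by (simp add: algebra_simps)
  qed (use assms w_pos c_pos a_half a_def hump in auto)
  have flux2: "(p2 0 - p2 L) / l = l * c * L"
    using l by (simp add: u2 power2_eq_square)
  have "l * L < 16 / w + (L - a)" using l \<open>L > 0\<close> by (simp add: Y_def field_simps)
  then have "c * (l * L) < c * (16 / w + (L - a))" using c_pos by simp
  then have "(p2 0 - p2 L) / l < p1 0 - p1 L"
    unfolding flux2 u1 by (simp add: algebra_simps)
  moreover have "0 < (p2 0 - p2 L) / l" using flux2 l c_pos \<open>L > 0\<close> by simp
  moreover have "u2 a < u1 a"
  proof -
    have "U * (1 - (a / L)\<^sup>2) < U" using \<open>U > 0\<close> a_pos \<open>L > 0\<close> by (simp add: mult_less_cancel_left1)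
    then show ?thesis using u2(3)[of a] u1(3) a_pos a_half by simp
  qed
  then have "\<exists>x\<in>{0..L}. u1 x \<noteq> u2 x"
    using a_pos a_half by (intro bexI[of _ a]) auto
  moreover have "w\<^sup>2 > 0" using w_pos by simp
  ultimately show ?thesis using that c_pos l(1) u1(1) u2(1) by blast
qed

section \<open>Two classical solutions\<close>

theorem theorem5p2:
  fixes Th Tc L Ac :: real and \<kappa> :: "real \<Rightarrow> real"
  assumes "Th > Tc" and "Tc \<ge> 0" and "L > 0" and "Ac > 0"
    and "Ck_on 1 {Tc..} \<kappa>"
    and "\<forall>t\<in>{Tc..}. \<kappa> t > 0"
  shows "\<exists>(\<rho> :: real \<Rightarrow> real) (Rload :: real) (\<alpha>0 :: real).
           locally_lipschitz_on {Tc..} \<rho> \<and>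
           (\<forall>t\<in>{Tc..}. \<rho> t > 0) \<and>
           (\<integral>\<^sup>+t\<in>{Tc..}. ennreal (\<rho> t * \<kappa> t) \<partial>lborel) = \<infinity> \<and>
           Rload > 0 \<and> \<alpha>0 \<noteq> 0 \<and>
           (\<exists>T\<^sub>1 T\<^sub>2. classical_solution Th Tc L Ac \<kappa> \<rho> Rload \<alpha>0 T\<^sub>1 \<and>
                    classical_solution Th Tc L Ac \<kappa> \<rho> Rload \<alpha>0 T\<^sub>2 \<and>
                    (\<exists>x\<in>{0..L}. T\<^sub>1 x \<noteq> T\<^sub>2 x))"
proof -
  obtain \<kappa>' where \<kappa>': "\<And>t. t \<in> {Tc..} \<Longrightarrow> (\<kappa> has_real_derivative \<kappa>' t) (at t within {Tc..})"
    and \<kappa>'_cont: "continuous_on {Tc..} \<kappa>'"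
    using assms(5) by auto
  have \<kappa>_cont: "continuous_on {Tc..} \<kappa>"
    using \<kappa>' DERIV_continuous_on by blast
  have \<kappa>_pos: "\<kappa> t > 0" if "t \<ge> Tc" for t using assms(6) that by simp
  obtain K G where K_Tc: "K Tc = 0" and K_mono: "strict_mono_on {Tc..} K"
    and K_deriv: "\<And>t. t \<ge> Tc \<Longrightarrow> (K has_real_derivative \<kappa> t) (at t)"
    and GK: "\<And>t. t \<ge> Tc \<Longrightarrow> G (K t) = t"
    and G_deriv: "\<And>t. t \<ge> Tc \<Longrightarrow> (G has_real_derivative inverse (\<kappa> t)) (at (K t))"
    using kirchhoff_transform[OF \<kappa>_cont \<kappa>_pos] by blast
  have U: "0 < K Th" "K Th < K (Th + 1)"
    using strict_mono_onD[OF K_mono, of Tc Th] strict_mono_onD[OF K_mono, of Th "Th + 1"]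
      K_Tc \<open>Th > Tc\<close> by auto
  obtain c k l u1 p1 u2 p2 where ckl: "c > 0" "k > 0" "l > 1"
    and u1: "Dirichlet_profile L (K Th) (K (Th + 1)) (\<lambda>v. c + k * max 0 (v - K Th)) u1 p1"
    and u2: "Dirichlet_profile L (K Th) (K (Th + 1)) (\<lambda>v. l\<^sup>2 * (c + k * max 0 (v - K Th))) u2 p2"
    and drop: "0 < (p2 0 - p2 L) / l" "(p2 0 - p2 L) / l < p1 0 - p1 L"
    and differ: "\<exists>x\<in>{0..L}. u1 x \<noteq> u2 x"
    using two_profiles[OF \<open>L > 0\<close> U] by blast
  define g where "g = (\<lambda>v. c + k * max 0 (v - K Th))"
  \<comment> \<open>The last term vanishes on \<open>[T\<^sub>c, T\<^sub>h + 1]\<close>, and its product with \<open>\<kappa>\<close> has infinite integral.\<close>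
  define \<rho> where "\<rho> = (\<lambda>t. g (K t) + max 0 ((t - (Th + 1)) / \<kappa> t))"
  \<comment> \<open>\<open>r\<close> stands for \<open>A\<^sub>c R\<^sub>l\<^sub>o\<^sub>a\<^sub>d\<close>; it is the solution of \<open>\<lambda>\<^sub>1 (I\<^sub>1 + r) = \<lambda>\<^sub>2 (I\<^sub>2 + r)\<close>, and \<open>V\<close> is the common value.\<close>
  define r where "r = ((p1 0 - p1 L) - (p2 0 - p2 L) / l) / (l - 1)"
  define V where "V = (p1 0 - p1 L) + r"
  have r_pos: "r > 0" using drop ckl by (simp add: r_def)
  have V_pos: "V > 0" using drop r_pos by (simp add: V_def)
  have "r * (l - 1) = (p1 0 - p1 L) - (p2 0 - p2 L) / l" using ckl by (simp add: r_def)
  then have V_eq: "V = (p2 0 - p2 L) / l + l * r" by (simp add: V_def algebra_simps)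
  have lipschitz: "locally_lipschitz_on {Tc..} \<rho>"
  proof (rule locally_lipschitz_onI)
    fix b
    \<comment> \<open>Each maximum is that of \<open>0\<close> and a \<open>C\<^sup>1\<close> function, and \<open>max 0\<close> keeps Lipschitz constants.\<close>
    define h where "h = (\<lambda>t. k * (K t - K Th))"
    have "(h has_real_derivative k * \<kappa> t) (at t within {Tc..})" if "t \<in> {Tc..}" for t
    proof -
      have "((\<lambda>t. K t - K Th) has_real_derivative \<kappa> t) (at t within {Tc..})"
        using DERIV_diff[OF K_deriv[of t] DERIV_const[of "K Th"]] that
        by (simp add: has_field_derivative_at_within)
      from DERIV_cmult[OF this, of k] show ?thesis by (simp add: h_def)
    qed
    then obtain C1 where C1: "C1-lipschitz_on {Tc..b} h"
      by (rule C1_lipschitz_on_interval) (auto intro: continuous_intros \<kappa>_cont)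
    define h2 where "h2 = (\<lambda>t. (t - (Th + 1)) / \<kappa> t)"
    have "(h2 has_real_derivative (1 * \<kappa> t - (t - (Th + 1)) * \<kappa>' t) / (\<kappa> t * \<kappa> t)) (at t within {Tc..})"
      if "t \<in> {Tc..}" for t
      unfolding h2_def
      by (rule DERIV_divide[OF _ \<kappa>'[OF that]]) (use that \<kappa>_pos[of t] in \<open>auto intro!: derivative_eq_intros\<close>)
    moreover have "continuous_on {Tc..} (\<lambda>t. (1 * \<kappa> t - (t - (Th + 1)) * \<kappa>' t) / (\<kappa> t * \<kappa> t))"
      using \<kappa>_pos by (intro continuous_intros \<kappa>_cont \<kappa>'_cont) force
    ultimately obtain C2 where C2: "C2-lipschitz_on {Tc..b} h2"
      by (rule C1_lipschitz_on_interval)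
    have "(0 + C1 + C2)-lipschitz_on {Tc..b} (\<lambda>t. c + max 0 (h t) + max 0 (h2 t))"
      by (intro lipschitz_on_add lipschitz_on_max_0 lipschitz_on_constant C1 C2)
    moreover have "\<rho> = (\<lambda>t. c + max 0 (h t) + max 0 (h2 t))"
      using ckl by (auto simp: \<rho>_def g_def h_def h2_def max_mult_distrib_left)
    ultimately show "\<exists>C. C-lipschitz_on {Tc..b} \<rho>" by auto
  qed
  have g_pos: "g v > 0" for v
    using ckl by (simp add: g_def add_pos_nonneg)
  then have \<rho>_pos: "\<forall>t\<in>{Tc..}. \<rho> t > 0"
    by (simp add: \<rho>_def add_pos_nonneg)
  have divergent: "(\<integral>\<^sup>+t\<in>{Tc..}. ennreal (\<rho> t * \<kappa> t) \<partial>lborel) = \<infinity>"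
  proof (rule nn_integral_infinite_halfline)
    fix t assume t: "t \<ge> Th + 2"
    then have pos: "\<kappa> t > 0" using \<kappa>_pos \<open>Th > Tc\<close> by simp
    have "1 \<le> (t - (Th + 1)) / \<kappa> t * \<kappa> t" using t pos by simp
    also have "\<dots> \<le> \<rho> t * \<kappa> t"
      using pos g_pos[of "K t"] by (intro mult_right_mono) (auto simp: \<rho>_def)
    finally show "1 \<le> \<rho> t * \<kappa> t" .
  qed (use \<open>Th > Tc\<close> in simp)
  have \<rho>_eq: "\<rho> t = g (K t)" if "t \<in> {Tc..Th + 1}" for t
    using that \<kappa>_pos[of t] divide_nonpos_pos[of "t - (Th + 1)" "\<kappa> t"] by (auto simp: \<rho>_def)
  have data: "Tc \<le> Th" "Tc \<le> Th + 1" "V / (Th - Tc) * (Th - Tc) = V"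
    using assms(1) by auto
  note solution = classical_solution_of_profile[where K = K and G = G and g = g and \<rho> = \<rho>,
      OF \<open>L > 0\<close> \<open>Ac > 0\<close> data(1,2) assms(5) \<kappa>_pos K_Tc K_deriv GK G_deriv \<rho>_eq]
  have sol1: "classical_solution Th Tc L Ac \<kappa> \<rho> (r / Ac) (V / (Th - Tc)) (\<lambda>x. G (u1 x))"
  proof (rule solution)
    show "Dirichlet_profile L (K Th) (K (Th + 1)) (\<lambda>v. 1\<^sup>2 * g v) u1 p1"
      using u1 by (simp add: g_def)
    show "V / (Th - Tc) * (Th - Tc) = (p1 0 - p1 L) / 1 + 1 * Ac * (r / Ac)"
      unfolding data(3) using \<open>Ac > 0\<close> by (simp add: V_def)
  qed (use V_pos data(3) in auto)
  have sol2: "classical_solution Th Tc L Ac \<kappa> \<rho> (r / Ac) (V / (Th - Tc)) (\<lambda>x. G (u2 x))"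
  proof (rule solution)
    show "Dirichlet_profile L (K Th) (K (Th + 1)) (\<lambda>v. l\<^sup>2 * g v) u2 p2"
      using u2 by (simp add: g_def)
    show "V / (Th - Tc) * (Th - Tc) = (p2 0 - p2 L) / l + l * Ac * (r / Ac)"
      unfolding data(3) using V_eq \<open>Ac > 0\<close> by simp
  qed (use V_pos data(3) ckl in auto)
  obtain x where x: "x \<in> {0..L}" "u1 x \<noteq> u2 x" using differ by blast
  have range: "u1 x \<in> {K Tc..K (Th + 1)}" "u2 x \<in> {K Tc..K (Th + 1)}"
    using u1 u2 x(1) unfolding Dirichlet_profile_def K_Tc by auto
  have "K (G v) = v" if "v \<in> {K Tc..K (Th + 1)}" for v
  proof -
    have "G v \<in> {Tc..Th + 1} \<and> K (G v) = v"
      by (intro left_inverse_imp_inverse data(2) DERIV_isCont[OF K_deriv] GK that) auto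
    then show ?thesis by blast
  qed
  then have "K (G (u1 x)) = u1 x" "K (G (u2 x)) = u2 x" using range by blast+
  with x have "\<exists>x\<in>{0..L}. G (u1 x) \<noteq> G (u2 x)" by metis
  moreover have "r / Ac > 0" "V / (Th - Tc) \<noteq> 0"
    using r_pos V_pos assms(1,4) by auto
  ultimately show ?thesis using lipschitz \<rho>_pos divergent sol1 sol2 by blast
qed

end
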